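(* The real Lie algebra $\mathfrak{su}(4)$ admits a decomposition into a direct sum of real vector subspaces $$\mathfrak{su}(4)=\mathfrak{k}\oplus\mathfrak{a}\oplus\mathfrak{a}'\oplus\mathfrak{t},$$ where $\mathfrak{t}$ is a Cartan subalgebra of $\mathfrak{su}(4)$, $\mathfrak{k}$ is a Lie subalgebra of $\mathfrak{su}(4)$ isomorphic to $\mathfrak{su}(2)\oplus\mathfrak{su}(2)$, and $\mathfrak{a}$ and $\mathfrak{a}'$ are 3-dimensional Abelian subalgebras of $\mathfrak{su}(4)$ such that $$[\mathfrak{a}',\mathfrak{a}]\subseteq\mathfrak{k}.$$ Furthermore, the components of this decomposition obey the commutation relations $$[\mathfrak{k},\mathfrak{k}]\subseteq\mathfrak{k},\qquad [\mathfrak{t},\mathfrak{a}]\subseteq\mathfrak{k},\qquad [\mathfrak{t},\mathfrak{a}']\subseteq\mathfrak{k},\qquad [\mathfrak{k},\mathfrak{t}]\subseteq\mathfrak{a}\oplus\mathfrak{a}'.$$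
   Context: $\mathfrak{su}(4)$ is the real Lie algebra of traceless anti-Hermitian complex $4\times4$ matrices with the matrix commutator as bracket, and $\mathfrak{su}(2)$ is the analogous algebra of $2\times 2$ matrices. For subspaces $V,W\subseteq\mathfrak{su}(4)$, $[V,W]$ denotes the real span of all commutators $[v,w]=vw-wv$ with $v\in V$, $w\in W$. The direct sum of the four components is a direct sum of vector spaces (not of Lie algebras). *)

theory Defs
  imports "HOL-Analysis.Analysis"
begin

definition conj_transpose :: "complex^'n^'m \<Rightarrow> complex^'m^'n" where
  "conj_transpose A = (\<chi> i j. cnj (A $ j $ i))"

definition mat_bracket :: "complex^'n^'n \<Rightarrow> complex^'n^'n \<Rightarrow> complex^'n^'n" where
  "mat_bracket A B = A ** B - B ** A"

definition su :: "(complex^'n^'n) set" where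
  "su = {A. trace A = 0 \<and> conj_transpose A = - A}"

text \<open>
  \<^const>\<open>subspace\<close>, \<^const>\<open>span\<close> and \<^const>\<open>dim\<close> are those of the real vector space structure,
  also on complex matrices. Sums \<open>V + W\<close> of sets are elementwise.
\<close>

definition bracket_span :: "(complex^'n^'n) set \<Rightarrow> (complex^'n^'n) set \<Rightarrow> (complex^'n^'n) set" where
  "bracket_span V W = span {mat_bracket v w |v w. v \<in> V \<and> w \<in> W}"

definition lie_subalgebra :: "(complex^'n^'n) set \<Rightarrow> (complex^'n^'n) set \<Rightarrow> bool" where
  "lie_subalgebra h g \<longleftrightarrow>
     subspace h \<and> h \<subseteq> g \<and> (\<forall>x\<in>h. \<forall>y\<in>h. mat_bracket x y \<in> h)"

definition abelian_subalgebra :: "(complex^'n^'n) set \<Rightarrow> (complex^'n^'n) set \<Rightarrow> bool" where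
  "abelian_subalgebra h g \<longleftrightarrow>
     lie_subalgebra h g \<and> (\<forall>x\<in>h. \<forall>y\<in>h. mat_bracket x y = 0)"

primrec lower_central :: "(complex^'n^'n) set \<Rightarrow> nat \<Rightarrow> (complex^'n^'n) set" where
  "lower_central h 0 = h"
| "lower_central h (Suc n) = bracket_span h (lower_central h n)"

definition lie_nilpotent :: "(complex^'n^'n) set \<Rightarrow> bool" where
  "lie_nilpotent h \<longleftrightarrow> (\<exists>n. lower_central h n = {0})"

definition lie_normalizer :: "(complex^'n^'n) set \<Rightarrow> (complex^'n^'n) set \<Rightarrow> (complex^'n^'n) set" where
  "lie_normalizer g h = {x \<in> g. \<forall>y\<in>h. mat_bracket x y \<in> h}"

definition cartan_subalgebra :: "(complex^'n^'n) set \<Rightarrow> (complex^'n^'n) set \<Rightarrow> bool" where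
  "cartan_subalgebra h g \<longleftrightarrow>
     lie_subalgebra h g \<and> lie_nilpotent h \<and> lie_normalizer g h = h"

definition prod_bracket ::
  "('a \<Rightarrow> 'a \<Rightarrow> 'a) \<Rightarrow> ('b \<Rightarrow> 'b \<Rightarrow> 'b) \<Rightarrow> 'a \<times> 'b \<Rightarrow> 'a \<times> 'b \<Rightarrow> 'a \<times> 'b" where
  "prod_bracket br1 br2 x y = (br1 (fst x) (fst y), br2 (snd x) (snd y))"

definition lie_isomorphic ::
  "('a::real_vector \<Rightarrow> 'a \<Rightarrow> 'a) \<Rightarrow> 'a set \<Rightarrow> ('b::real_vector \<Rightarrow> 'b \<Rightarrow> 'b) \<Rightarrow> 'b set \<Rightarrow> bool" where
  "lie_isomorphic br1 g br2 h \<longleftrightarrow>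
     (\<exists>f. bij_betw f g h \<and>
          (\<forall>x\<in>g. \<forall>y\<in>g. f (x + y) = f x + f y) \<and>
          (\<forall>c. \<forall>x\<in>g. f (c *\<^sub>R x) = c *\<^sub>R f x) \<and>
          (\<forall>x\<in>g. \<forall>y\<in>g. f (br1 x y) = br2 (f x) (f y)))"

definition internal_direct_sum :: "'a::real_vector set \<Rightarrow> 'a set list \<Rightarrow> bool" where
  "internal_direct_sum V Us \<longleftrightarrow>
     (\<forall>U\<in>set Us. subspace U) \<and> V = sum_list Us \<and>
     (\<forall>xs. list_all2 (\<in>) xs Us \<and> sum_list xs = 0 \<longrightarrow> (\<forall>x\<in>set xs. x = 0))"

end

theory Submission
  imports Defs
begin

text \<open>
  Entrywise complex conjugation of \<open>su(n)\<close> splits it into the real matrices, which form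
  \<open>so(n)\<close>, and the purely imaginary ones. Since a product of two real or of two imaginary numbers
  is real and a mixed product is imaginary, this splitting is a grading over the integers modulo 2:
  the bracket of two matrices of the same kind is real, that of two matrices of different kinds is
  imaginary. Take \<open>k = so(4)\<close> and let \<open>t\<close> be the diagonal subalgebra, which is imaginary. If \<open>a\<close>
  and \<open>a'\<close> consist of imaginary matrices as well, then \<open>[a', a]\<close>, \<open>[t, a]\<close>, \<open>[t, a']\<close> and
  \<open>[k, k]\<close> are real, hence in \<open>k\<close>, for free. The bracket of any matrix with a diagonal one has zero
  diagonal, so \<open>[k, t]\<close> lies in the six-dimensional space of imaginary symmetric matrices with
  zero diagonal.

  What is special to size 4 is twofold. The space of imaginary symmetric matrices with zero
  diagonal is the sum of two commuting triples. The three ways to split the four indices into two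
  pairs give the three nontrivial translations of the Klein four-group, whose permutation matrices
  are symmetric, commute, and have zero diagonal; \<open>\<i>\<close> times these matrices span \<open>a\<close>. Giving
  opposite signs to the two transpositions of each of these permutations yields three matrices that
  commute again, and \<open>\<i>\<close> times these span \<open>a'\<close>. In terms of Pauli matrices the two triples are
  \<open>1 \<otimes> X, X \<otimes> 1, X \<otimes> X\<close> and \<open>Z \<otimes> X, X \<otimes> Z, Y \<otimes> Y\<close>. Secondly, \<open>so(4)\<close> splits into its
  self-dual and anti-self-dual parts, each of which is a copy of the cross product algebra on
  \<open>\<real>\<^sup>3\<close>, that is, of \<open>su(2)\<close>.
\<close>

section \<open>Brackets in the special unitary Lie algebra\<close>

lemma mat_bracket_component:
  "mat_bracket A B $ i $ j = (\<Sum>l\<in>UNIV. A $ i $ l * B $ l $ j - B $ i $ l * A $ l $ j)"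
  by (simp add: mat_bracket_def matrix_matrix_mult_def sum_subtractf)

lemma mem_su_iff:
  "A \<in> su \<longleftrightarrow> (\<Sum>i\<in>UNIV. A $ i $ i) = 0 \<and> (\<forall>i j. cnj (A $ j $ i) = - (A $ i $ j))"
  by (simp add: su_def trace_def conj_transpose_def vec_eq_iff)

lemma su_adjoint: "A \<in> su \<Longrightarrow> cnj (A $ j $ i) = - (A $ i $ j)"
  by (simp add: mem_su_iff)

lemma subspace_su: "subspace (su :: (complex^'n^'n) set)"
proof (rule subspaceI)
  fix c :: real and A :: "complex^'n^'n"
  assume A: "A \<in> su"
  have "(\<Sum>i\<in>UNIV. (c *\<^sub>R A) $ i $ i) = c *\<^sub>R (\<Sum>i\<in>UNIV. A $ i $ i)"
    by (simp only: vector_scaleR_component scaleR_sum_right)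
  with A show "c *\<^sub>R A \<in> su" by (simp add: mem_su_iff)
qed (simp_all add: mem_su_iff sum.distrib)

lemma mat_bracket_in_su:
  assumes "A \<in> su" "B \<in> su"
  shows "mat_bracket A B \<in> su"
proof -
  have "trace (mat_bracket A B) = 0"
    by (simp add: mat_bracket_def trace_sub trace_mul_sym[of A B])
  moreover have "cnj (mat_bracket A B $ j $ i) = - (mat_bracket A B $ i $ j)" for i j
    unfolding mat_bracket_component cnj_sum sum_negf[symmetric]
    using assms by (intro sum.cong) (simp_all add: su_adjoint mult.commute)
  ultimately show ?thesis
    by (simp add: mem_su_iff trace_def)
qed

lemma bracket_span_subset:
  assumes "subspace U" "\<And>v w. v \<in> V \<Longrightarrow> w \<in> W \<Longrightarrow> mat_bracket v w \<in> U"
  shows "bracket_span V W \<subseteq> U"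
  unfolding bracket_span_def using assms by (intro span_minimal) auto

section \<open>The grading into real and imaginary matrices\<close>

definition real_su :: "(complex^'n^'n) set" where
  "real_su = {A \<in> su. \<forall>i j. Im (A $ i $ j) = 0}"

definition imag_su :: "(complex^'n^'n) set" where
  "imag_su = {A \<in> su. \<forall>i j. Re (A $ i $ j) = 0}"

lemma subspace_real_su: "subspace real_su"
  using subspace_su by (auto simp: real_su_def subspace_def)

lemma bracket_real_real: "A \<in> real_su \<Longrightarrow> B \<in> real_su \<Longrightarrow> mat_bracket A B \<in> real_su"
  by (simp add: real_su_def mat_bracket_in_su mat_bracket_component)

lemma bracket_imag_imag: "A \<in> imag_su \<Longrightarrow> B \<in> imag_su \<Longrightarrow> mat_bracket A B \<in> real_su"
  by (simp add: real_su_def imag_su_def mat_bracket_in_su mat_bracket_component)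

lemma bracket_real_imag: "A \<in> real_su \<Longrightarrow> B \<in> imag_su \<Longrightarrow> mat_bracket A B \<in> imag_su"
  by (simp add: real_su_def imag_su_def mat_bracket_in_su mat_bracket_component)

lemma lie_subalgebra_real_su: "lie_subalgebra real_su su"
  using subspace_real_su bracket_real_real by (auto simp: lie_subalgebra_def real_su_def)

lemma real_su_antisym: "A \<in> real_su \<Longrightarrow> A $ j $ i = - (A $ i $ j)"
  using su_adjoint[of A j i] by (simp add: real_su_def complex_eq_iff)

lemma imag_su_sym: "A \<in> imag_su \<Longrightarrow> A $ j $ i = A $ i $ j"
  using su_adjoint[of A j i] by (simp add: imag_su_def complex_eq_iff)

section \<open>The diagonal Cartan subalgebra\<close>

definition diag_su :: "(complex^'n^'n) set" where
  "diag_su = {A \<in> su. \<forall>i j. i \<noteq> j \<longrightarrow> A $ i $ j = 0}"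

lemma subspace_diag_su: "subspace diag_su"
  using subspace_su by (auto simp: diag_su_def subspace_def)

lemma diag_su_subset_imag: "diag_su \<subseteq> imag_su"
proof
  fix A :: "complex^'n^'n" assume A: "A \<in> diag_su"
  have "Re (A $ i $ j) = 0" for i j
    using A su_adjoint[of A i i] by (cases "i = j") (auto simp: diag_su_def complex_eq_iff)
  with A show "A \<in> imag_su" by (simp add: diag_su_def imag_su_def)
qed

text \<open>The matrix units are the root vectors: a diagonal matrix acts on the entry at \<open>(i, j)\<close> by a
  difference of two of its eigenvalues.\<close>

lemma bracket_diag_component:
  assumes "D \<in> diag_su"
  shows "mat_bracket A D $ i $ j = A $ i $ j * (D $ j $ j - D $ i $ i)"
proof -
  have "D $ p $ q = 0" if "p \<noteq> q" for p q
    using assms that by (simp add: diag_su_def)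
  then have "mat_bracket A D $ i $ j =
      (\<Sum>l\<in>UNIV. (if l = j then A $ i $ l * D $ j $ j else 0)) -
      (\<Sum>l\<in>UNIV. (if i = l then D $ l $ l * A $ l $ j else 0))"
    unfolding mat_bracket_component sum_subtractf
    by (intro arg_cong2[of _ _ _ _ "(-)"] sum.cong) auto
  then show ?thesis by (simp add: algebra_simps)
qed

lemma bracket_diag_diag: "A \<in> diag_su \<Longrightarrow> D \<in> diag_su \<Longrightarrow> mat_bracket A D = 0"
  unfolding vec_eq_iff
proof (intro allI)
  fix i j
  assume "A \<in> diag_su" "D \<in> diag_su"
  then show "mat_bracket A D $ i $ j = 0 $ i $ j"
    by (cases "i = j") (simp_all add: bracket_diag_component, simp add: diag_su_def)
qed

text \<open>For every root there is a diagonal matrix on which it does not vanish, so a matrix that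
  normalizes the diagonal has no off-diagonal entry.\<close>

lemma cartan_diag_su: "cartan_subalgebra (diag_su :: (complex^'n^'n) set) su"
  unfolding cartan_subalgebra_def
proof (intro conjI)
  have zero: "(0 :: complex^'n^'n) \<in> diag_su"
    by (rule subspace_0[OF subspace_diag_su])
  have sub: "(diag_su :: (complex^'n^'n) set) \<subseteq> su"
    by (auto simp: diag_su_def)
  show "lie_subalgebra (diag_su :: (complex^'n^'n) set) su"
    using zero sub by (simp add: lie_subalgebra_def subspace_diag_su bracket_diag_diag)
  have "bracket_span (diag_su :: (complex^'n^'n) set) diag_su \<subseteq> {0}"
    by (rule bracket_span_subset) (auto simp: bracket_diag_diag)
  then have "lower_central (diag_su :: (complex^'n^'n) set) 1 = {0}"
    using span_zero by (fastforce simp: bracket_span_def)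
  then show "lie_nilpotent (diag_su :: (complex^'n^'n) set)"
    unfolding lie_nilpotent_def by blast
  show "lie_normalizer su diag_su = (diag_su :: (complex^'n^'n) set)"
  proof
    show "(diag_su :: (complex^'n^'n) set) \<subseteq> lie_normalizer su diag_su"
      using zero sub by (auto simp: lie_normalizer_def bracket_diag_diag)
    show "lie_normalizer su diag_su \<subseteq> (diag_su :: (complex^'n^'n) set)"
    proof
      fix A :: "complex^'n^'n" assume A: "A \<in> lie_normalizer su diag_su"
      have "A $ i $ j = 0" if "i \<noteq> j" for i j
      proof -
        define D :: "complex^'n^'n" where
          "D = (\<chi> p q. if p = q then (if p = i then \<i> else 0) - (if p = j then \<i> else 0) else 0)"
        have D: "D \<in> diag_su"
          by (auto simp: diag_su_def mem_su_iff D_def sum_subtractf)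
        then have "mat_bracket A D \<in> diag_su"
          using A by (simp add: lie_normalizer_def)
        then have "mat_bracket A D $ i $ j = 0"
          using that by (simp add: diag_su_def)
        then show ?thesis
          using that by (simp add: bracket_diag_component[OF D]) (simp add: D_def)
      qed
      then show "A \<in> diag_su"
        using A by (simp add: lie_normalizer_def diag_su_def)
    qed
  qed
qed

section \<open>The two Klein triples\<close>

lemma vector_4:
  "(vector [w, x, y, z] :: 'a::zero^4) $ 1 = w"
  "(vector [w, x, y, z] :: 'a::zero^4) $ 2 = x"
  "(vector [w, x, y, z] :: 'a::zero^4) $ 3 = y"
  "(vector [w, x, y, z] :: 'a::zero^4) $ 4 = z"
  by (simp_all add: vector_def)

text \<open>The coordinates of \<open>u\<close> belong to the pairings \<open>12|34\<close>, \<open>13|24\<close> and \<open>14|23\<close> of the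
  indices, and \<open>e\<close> is the relative sign of the two pairs of a pairing.\<close>

definition klein :: "real \<Rightarrow> real^3 \<Rightarrow> complex^4^4" where
  "klein e u = (\<chi> i j. \<i> * of_real (vector
     [vector [0, u $ 1, u $ 2, u $ 3],
      vector [u $ 1, 0, e * u $ 3, e * u $ 2],
      vector [u $ 2, e * u $ 3, 0, e * u $ 1],
      vector [u $ 3, e * u $ 2, e * u $ 1, 0]] $ i $ j))"

lemma linear_klein: "linear (klein e)"
  by (rule linearI)
    (simp_all add: klein_def vec_eq_iff forall_4 vector_4 complex_eq_iff algebra_simps)

lemma inj_klein: "inj (klein e)"
  by (rule injI) (simp add: klein_def vec_eq_iff forall_4 forall_3 vector_4)

lemma dim_range_klein: "dim (range (klein e)) = 3"
proof -
  have "dim (range (klein e)) = dim (UNIV :: (real^3) set)"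
    using linear_klein inj_klein by (intro dim_image_eq) auto
  then show ?thesis by (simp add: dim_UNIV)
qed

lemma klein_in_imag_su: "klein e u \<in> imag_su"
  by (simp add: imag_su_def mem_su_iff klein_def forall_4 sum_4 vector_4)

text \<open>In the product of the basis matrices of two pairings some entries carry \<open>1\<close> in one order and
  \<open>e\<^sup>2\<close> in the other, and all further entries agree. So \<open>e\<^sup>2 = 1\<close> is what makes them commute.\<close>

lemma bracket_klein:
  assumes "e\<^sup>2 = 1"
  shows "mat_bracket (klein e u) (klein e v) = 0"
proof -
  have cancel: "e * (e * x) = x" for x
    using assms by (simp add: power2_eq_square flip: mult.assoc)
  show ?thesis
    by (simp add: cancel vec_eq_iff forall_4 mat_bracket_component sum_4 klein_def vector_4
        complex_eq_iff algebra_simps)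
qed

lemma abelian_range_klein:
  assumes "e\<^sup>2 = 1"
  shows "abelian_subalgebra (range (klein e)) su"
proof -
  have sub: "subspace (range (klein e))"
    by (rule linear_subspace_image[OF linear_klein subspace_UNIV])
  then show ?thesis
    using klein_in_imag_su subspace_0[OF sub]
    by (auto simp: abelian_subalgebra_def lie_subalgebra_def bracket_klein[OF assms] imag_su_def)
qed

text \<open>A symmetric imaginary matrix with zero diagonal has one pair of free entries for each pairing;
  half their sum and half their difference are its coordinates in the two triples.\<close>

lemma zero_diagonal_imag_decomposition:
  fixes S :: "complex^4^4"
  assumes "S \<in> imag_su" "\<And>i. S $ i $ i = 0"
  shows "S \<in> range (klein 1) + range (klein (-1))"
proof -
  define u :: "real^3" where
    "u = vector [(Im (S $ 1 $ 2) + Im (S $ 3 $ 4)) / 2, (Im (S $ 1 $ 3) + Im (S $ 2 $ 4)) / 2,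
       (Im (S $ 1 $ 4) + Im (S $ 2 $ 3)) / 2]"
  define v :: "real^3" where
    "v = vector [(Im (S $ 1 $ 2) - Im (S $ 3 $ 4)) / 2, (Im (S $ 1 $ 3) - Im (S $ 2 $ 4)) / 2,
       (Im (S $ 1 $ 4) - Im (S $ 2 $ 3)) / 2]"
  have re: "Re (S $ i $ j) = 0" for i j
    using assms(1) by (simp add: imag_su_def)
  have "S = klein 1 u + klein (-1) v"
    using imag_su_sym[OF assms(1), of 1 2] imag_su_sym[OF assms(1), of 1 3]
      imag_su_sym[OF assms(1), of 1 4] imag_su_sym[OF assms(1), of 2 3]
      imag_su_sym[OF assms(1), of 2 4] imag_su_sym[OF assms(1), of 3 4]
    by (simp add: vec_eq_iff forall_4 klein_def vector_4 complex_eq_iff re assms(2) u_def v_def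
        field_simps)
  then show ?thesis by auto
qed

lemma klein_triples_independent:
  assumes "klein 1 u + klein (-1) v = 0"
  shows "u = 0" "v = 0"
  using assms by (simp_all add: vec_eq_iff forall_4 forall_3 klein_def vector_4 complex_eq_iff)

section \<open>The decomposition\<close>

lemma su4_direct_sum:
  "internal_direct_sum su [real_su, range (klein 1), range (klein (-1)), diag_su]"
  unfolding internal_direct_sum_def
proof (intro conjI allI impI)
  show "\<forall>U\<in>set [real_su, range (klein 1), range (klein (-1)), diag_su]. subspace U"
    using subspace_real_su subspace_diag_su
    by (simp add: linear_subspace_image[OF linear_klein subspace_UNIV])
  have "A \<in> real_su + (range (klein 1) + (range (klein (-1)) + diag_su))"
    if A: "A \<in> su" for A
  proof -
    define R :: "complex^4^4" where "R = (\<chi> i j. of_real (Re (A $ i $ j)))"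
    define D :: "complex^4^4" where
      "D = (\<chi> i j. if i = j then \<i> * of_real (Im (A $ i $ j)) else 0)"
    define S :: "complex^4^4" where
      "S = (\<chi> i j. if i = j then 0 else \<i> * of_real (Im (A $ i $ j)))"
    have re: "Re (A $ j $ i) = - Re (A $ i $ j)" and im: "Im (A $ j $ i) = Im (A $ i $ j)" for i j
      using su_adjoint[OF A, of j i] by (simp_all add: complex_eq_iff)
    have tr: "(\<Sum>i\<in>UNIV. A $ i $ i) = 0"
      using A by (simp add: mem_su_iff)
    have "R \<in> real_su"
      using arg_cong[OF tr, of Re]
      by (auto simp: real_su_def mem_su_iff R_def complex_eq_iff intro: re)
    have "D \<in> diag_su"
      using arg_cong[OF tr, of Im]
      by (auto simp: diag_su_def mem_su_iff D_def complex_eq_iff)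
    have "S \<in> imag_su"
      by (auto simp: imag_su_def mem_su_iff S_def complex_eq_iff intro: im)
    then obtain u v where "S = klein 1 u + klein (-1) v"
      using zero_diagonal_imag_decomposition[of S] by (auto simp: S_def elim!: set_plus_elim)
    moreover have "A = R + (S + D)"
      by (simp add: vec_eq_iff R_def S_def D_def complex_eq_iff)
    ultimately have "A = R + (klein 1 u + (klein (-1) v + D))"
      by (simp add: add.assoc)
    with \<open>R \<in> real_su\<close> \<open>D \<in> diag_su\<close> show ?thesis
      by (simp add: set_plus_intro)
  qed
  moreover have "A \<in> su"
    if "A \<in> real_su + (range (klein 1) + (range (klein (-1)) + diag_su))" for A
    using that klein_in_imag_su
    by (auto elim!: set_plus_elim simp: real_su_def diag_su_def imag_su_def
        intro!: subspace_add[OF subspace_su])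
  ultimately show "su = sum_list [real_su, range (klein 1), range (klein (-1)), diag_su]"
    by auto
next
  fix xs :: "(complex^4^4) list"
  assume "list_all2 (\<in>) xs [real_su, range (klein 1), range (klein (-1)), diag_su] \<and>
    sum_list xs = 0"
  then obtain R u v D where xs: "xs = [R, klein 1 u, klein (-1) v, D]"
    and R: "R \<in> real_su" and D: "D \<in> diag_su"
    and sum: "R + (klein 1 u + (klein (-1) v + D)) = 0"
    by (auto simp: list_all2_Cons2)
  have entry: "R $ i $ j + (klein 1 u $ i $ j + (klein (-1) v $ i $ j + D $ i $ j)) = 0" for i j
    using arg_cong[OF sum, of "\<lambda>M. M $ i $ j"] by simp
  have "Re (D $ i $ j) = 0" for i j
    using D diag_su_subset_imag by (auto simp: imag_su_def)
  \<comment> \<open>The grading separates \<open>R\<close> from the other summands, the diagonal separates \<open>D\<close>.\<close>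
  then have "R = 0"
    using R arg_cong[OF entry, of Re] klein_in_imag_su[of 1 u] klein_in_imag_su[of "-1" v]
    by (simp add: vec_eq_iff complex_eq_iff real_su_def imag_su_def)
  moreover have "klein e w $ i $ i = 0" for e w i
    using exhaust_4[of i] by (auto simp: klein_def vector_4)
  then have "D $ i $ j = 0" for i j
    using D entry[of i i] \<open>R = 0\<close> by (cases "i = j") (auto simp: diag_su_def)
  then have "D = 0" by (simp add: vec_eq_iff)
  ultimately have "klein 1 u + klein (-1) v = 0"
    using sum by simp
  with \<open>R = 0\<close> \<open>D = 0\<close> klein_triples_independent[of u v] show "\<forall>x\<in>set xs. x = 0"
    by (simp add: xs linear_0[OF linear_klein])
qed

section \<open>The isomorphism between so(4) and two copies of su(2)\<close>

text \<open>The vector \<open>w\<close> is sent to \<open>- \<i> / 2\<close> times its combination of the three Pauli matrices; the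
  factor makes the cross product correspond to the commutator.\<close>

definition su2_of :: "real^3 \<Rightarrow> complex^2^2" where
  "su2_of w = vector [vector [Complex 0 (- w $ 3 / 2), Complex (- w $ 2 / 2) (- w $ 1 / 2)],
                      vector [Complex (w $ 2 / 2) (- w $ 1 / 2), Complex 0 (w $ 3 / 2)]]"

lemma linear_su2_of: "linear su2_of"
  by (rule linearI)
    (simp_all add: su2_of_def vec_eq_iff forall_2 complex_eq_iff field_simps)

lemma su2_of_cross: "su2_of (cross3 v w) = mat_bracket (su2_of v) (su2_of w)"
  by (simp add: vec_eq_iff forall_2 mat_bracket_component sum_2 su2_of_def cross_components
      complex_eq_iff field_simps)

lemma inj_su2_of: "inj su2_of"
  by (rule injI) (simp add: su2_of_def vec_eq_iff forall_2 forall_3)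

lemma range_su2_of: "range su2_of = su"
proof
  show "range su2_of \<subseteq> su"
    by (auto simp: mem_su_iff su2_of_def forall_2 sum_2 complex_eq_iff)
  show "su \<subseteq> range su2_of"
  proof
    fix A :: "complex^2^2" assume A: "A \<in> su"
    have "Re (A $ 1 $ 1) = 0" "Re (A $ 2 $ 2) = 0"
      "Re (A $ 2 $ 1) = - Re (A $ 1 $ 2)" "Im (A $ 2 $ 1) = Im (A $ 1 $ 2)"
      using su_adjoint[OF A, of 1 1] su_adjoint[OF A, of 2 2] su_adjoint[OF A, of 1 2]
      by (simp_all add: complex_eq_iff)
    moreover have "Im (A $ 2 $ 2) = - Im (A $ 1 $ 1)"
      using A by (simp add: mem_su_iff sum_2 complex_eq_iff add_eq_0_iff)
    ultimately have
      "A = su2_of (vector [-2 * Im (A $ 1 $ 2), -2 * Re (A $ 1 $ 2), -2 * Im (A $ 1 $ 1)])"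
      by (simp add: su2_of_def vec_eq_iff forall_2 complex_eq_iff)
    then show "A \<in> range su2_of" by blast
  qed
qed

text \<open>Up to sign, these are the coordinates of a two-form on \<open>\<real>\<^sup>4\<close> in its self-dual and
  anti-self-dual components. The overall sign in the first is forced: without it the bracket would
  become the negative of the cross product.\<close>

definition selfdual :: "complex^4^4 \<Rightarrow> real^3" where
  "selfdual A = vector [- Re (A $ 1 $ 2) - Re (A $ 3 $ 4), Re (A $ 2 $ 4) - Re (A $ 1 $ 3),
     - Re (A $ 1 $ 4) - Re (A $ 2 $ 3)]"

definition antiselfdual :: "complex^4^4 \<Rightarrow> real^3" where
  "antiselfdual A = vector [Re (A $ 1 $ 2) - Re (A $ 3 $ 4), Re (A $ 1 $ 3) + Re (A $ 2 $ 4),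
     Re (A $ 1 $ 4) - Re (A $ 2 $ 3)]"

lemma linear_selfdual: "linear selfdual"
  by (rule linearI) (simp_all add: selfdual_def vec_eq_iff forall_3 algebra_simps)

lemma linear_antiselfdual: "linear antiselfdual"
  by (rule linearI) (simp_all add: antiselfdual_def vec_eq_iff forall_3 algebra_simps)

lemma real_su4_entries:
  fixes A :: "complex^4^4"
  assumes "A \<in> real_su"
  shows "A $ 2 $ 1 = - (A $ 1 $ 2)" "A $ 3 $ 1 = - (A $ 1 $ 3)" "A $ 4 $ 1 = - (A $ 1 $ 4)"
    "A $ 3 $ 2 = - (A $ 2 $ 3)" "A $ 4 $ 2 = - (A $ 2 $ 4)" "A $ 4 $ 3 = - (A $ 3 $ 4)"
    "A $ i $ i = 0" "Im (A $ i $ j) = 0"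
proof -
  show "A $ i $ i = 0" "Im (A $ i $ j) = 0"
    using real_su_antisym[OF assms, of i i] assms
    by (simp_all add: real_su_def complex_eq_iff)
qed (rule real_su_antisym[OF assms])+

lemma
  assumes "A \<in> real_su" "B \<in> real_su"
  shows selfdual_bracket: "selfdual (mat_bracket A B) = cross3 (selfdual A) (selfdual B)"
    and antiselfdual_bracket:
      "antiselfdual (mat_bracket A B) = cross3 (antiselfdual A) (antiselfdual B)"
  by (simp_all add: vec_eq_iff forall_3 selfdual_def antiselfdual_def cross_components
      mat_bracket_component sum_4 real_su4_entries[OF assms(1)] real_su4_entries[OF assms(2)]
      algebra_simps)

text \<open>The six coordinates determine the six entries above the diagonal, and these are arbitrary.\<close>

lemma bij_betw_dual_parts:
  "bij_betw (\<lambda>A. (selfdual A, antiselfdual A)) real_su UNIV"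
  unfolding bij_betw_def
proof
  show "inj_on (\<lambda>A. (selfdual A, antiselfdual A)) real_su"
  proof (rule inj_onI)
    fix A B :: "complex^4^4"
    assume "A \<in> real_su" "B \<in> real_su"
      "(selfdual A, antiselfdual A) = (selfdual B, antiselfdual B)"
    then show "A = B"
      by (simp add: vec_eq_iff forall_4 forall_3 complex_eq_iff real_su4_entries
          selfdual_def antiselfdual_def)
  qed
  have "(u, v) \<in> (\<lambda>A. (selfdual A, antiselfdual A)) ` real_su" for u v
  proof -
    \<comment> \<open>The vectors \<open>p\<close> and \<open>- q\<close> hold the entries \<open>12, 13, 14\<close> and \<open>34, 42, 23\<close>.\<close>
    define p q where "p = (\<chi> i. (v $ i - u $ i) / 2)" and "q = (\<chi> i. (v $ i + u $ i) / 2)"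
    define A :: "complex^4^4" where
      "A = (\<chi> i j. of_real (vector
        [vector [0, p $ 1, p $ 2, p $ 3],
         vector [- p $ 1, 0, - q $ 3, q $ 2],
         vector [- p $ 2, q $ 3, 0, - q $ 1],
         vector [- p $ 3, - q $ 2, q $ 1, 0]] $ i $ j))"
    have "A \<in> real_su"
      by (simp add: real_su_def mem_su_iff A_def forall_4 sum_4 vector_4)
    moreover have "selfdual A = u" "antiselfdual A = v"
      by (simp_all add: selfdual_def antiselfdual_def A_def vec_eq_iff forall_3 vector_4
          p_def q_def field_simps)
    ultimately show ?thesis by force
  qed
  then show "(\<lambda>A. (selfdual A, antiselfdual A)) ` real_su = UNIV"
    by auto
qed

lemma so4_isomorphic_su2_su2:
  "lie_isomorphic mat_bracket (real_su :: (complex^4^4) set)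
     (prod_bracket mat_bracket mat_bracket)
     ((su :: (complex^2^2) set) \<times> (su :: (complex^2^2) set))"
  unfolding lie_isomorphic_def
proof (intro exI[of _ "map_prod su2_of su2_of \<circ> (\<lambda>A. (selfdual A, antiselfdual A))"] conjI)
  have "bij_betw (map_prod su2_of su2_of) UNIV (su \<times> su)"
    using inj_su2_of range_su2_of
    by (auto simp: bij_betw_def map_prod_surj_on[of su2_of UNIV su su2_of UNIV su, simplified]
        intro: prod.inj_map)
  then show "bij_betw (map_prod su2_of su2_of \<circ> (\<lambda>A. (selfdual A, antiselfdual A)))
      real_su (su \<times> su)"
    by (rule bij_betw_trans[OF bij_betw_dual_parts])
qed (simp_all add: linear_add[OF linear_selfdual] linear_add[OF linear_antiselfdual]
    linear_add[OF linear_su2_of] linear_scale[OF linear_selfdual]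
    linear_scale[OF linear_antiselfdual] linear_scale[OF linear_su2_of]
    selfdual_bracket antiselfdual_bracket su2_of_cross prod_bracket_def)

theorem propositionI:
  shows "\<exists>(k :: (complex^4^4) set) a a' t.
    internal_direct_sum su [k, a, a', t] \<and>
    cartan_subalgebra t su \<and>
    lie_subalgebra k su \<and>
    lie_isomorphic mat_bracket k
      (prod_bracket mat_bracket mat_bracket)
      ((su :: (complex^2^2) set) \<times> (su :: (complex^2^2) set)) \<and>
    abelian_subalgebra a su \<and> dim a = 3 \<and>
    abelian_subalgebra a' su \<and> dim a' = 3 \<and>
    bracket_span a' a \<subseteq> k \<and>
    bracket_span k k \<subseteq> k \<and>
    bracket_span t a \<subseteq> k \<and>
    bracket_span t a' \<subseteq> k \<and>
    bracket_span k t \<subseteq> a + a'"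
proof (intro exI conjI)
  show "internal_direct_sum su [real_su, range (klein 1), range (klein (-1)), diag_su]"
    by (rule su4_direct_sum)
  show "abelian_subalgebra (range (klein 1)) su" "abelian_subalgebra (range (klein (-1))) su"
    by (simp_all add: abelian_range_klein)
  have imag: "range (klein e) \<subseteq> imag_su" for e
    using klein_in_imag_su by blast
  have real: "bracket_span V W \<subseteq> real_su"
    if "V \<subseteq> imag_su" "W \<subseteq> imag_su" for V W :: "(complex^4^4) set"
    using that by (intro bracket_span_subset subspace_real_su bracket_imag_imag) auto
  show "bracket_span (range (klein (-1))) (range (klein 1)) \<subseteq> real_su"
    "bracket_span diag_su (range (klein 1)) \<subseteq> real_su"
    "bracket_span diag_su (range (klein (-1))) \<subseteq> real_su"
    by (intro real imag diag_su_subset_imag)+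
  show "bracket_span real_su real_su \<subseteq> (real_su :: (complex^4^4) set)"
    by (intro bracket_span_subset subspace_real_su bracket_real_real)
  show "bracket_span real_su diag_su \<subseteq> range (klein 1) + range (klein (-1))"
  proof (rule bracket_span_subset)
    have sub: "subspace (range (klein e))" for e
      by (rule linear_subspace_image[OF linear_klein subspace_UNIV])
    have "range (klein 1) + range (klein (-1)) =
        {x + y |x y. x \<in> range (klein 1) \<and> y \<in> range (klein (-1))}"
      unfolding set_plus_def by blast
    then show "subspace (range (klein 1) + range (klein (-1)))"
      using subspace_sums[OF sub[of 1] sub[of "-1"]] by (simp only:)
    show "mat_bracket A D \<in> range (klein 1) + range (klein (-1))"
      if "A \<in> real_su" "D \<in> diag_su" for A D
      using that diag_su_subset_imag
      by (intro zero_diagonal_imag_decomposition bracket_real_imag)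
        (auto simp: bracket_diag_component)
  qed
qed (rule cartan_diag_su lie_subalgebra_real_su so4_isomorphic_su2_su2 dim_range_klein)+

end
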